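(* Let $G$ be a connected graph. The following statements are equivalent: (1) $G$ is weakly $f$-degenerate, where $f(u)=\deg_G(u)-1$ for all $u\in V(G)$; (2) $G$ is not a GDP-tree.
   Context: All graphs are finite and simple; $\mathbb{N}=\{0,1,2,\ldots\}$. Connected graphs are nonempty. A GDP-tree is a connected graph in which every block is either a clique (complete graph) or a cycle. (A block is a maximal connected subgraph without cut vertices of its own; in particular, the single-vertex graph is a GDP-tree whose only block is $K_1$.) Weak degeneracy: let $G$ be a graph and $f\colon V(G)\to\mathbb{N}$. For a vertex $u$, the operation $\mathrm{Delete}(G,f,u)$ outputs $G'=G-u$ and $f'\colon V(G')\to\mathbb{Z}$ with $f'(v)=f(v)-1$ if $uv\in E(G)$ and $f'(v)=f(v)$ otherwise; its application is legal if $f'(v)\geq 0$ for all $v\in V(G')$. For adjacent vertices $u,w$, the operation $\mathrm{DelSave}(G,f,u,w)$ outputs $G'=G-u$ and $f'\colon V(G')\to\mathbb{Z}$ with $f'(v)=f(v)-1$ if $uv\in E(G)$ and $v\neq w$, and $f'(v)=f(v)$ otherwise; its application is legal if $f(u)>f(w)$ and $f'$ is non-negative. $G$ is weakly $f$-degenerate if all vertices of $G$ can be removed by a sequence of legal applications of Delete and DelSave, starting with $(G,f)$. Convention: if $f\colon V(G)\to\mathbb{Z}$ takes a negative value at some vertex of $G$, then $G$ is not weakly $f$-degenerate. *)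

theory Defs
  imports "Graph_Theory.Digraph_Component" "Graph_Theory.Kuratowski"
begin

text \<open>
  A finite simple graph is an instance of the locale \<open>graph\<close>: a finite symmetric digraph without
  loops and parallel arcs, each edge \<open>uv\<close> being the pair of arcs \<open>(u,v)\<close> and \<open>(v,u)\<close>.
  Adjacency is \<open>u \<rightarrow>\<^bsub>G\<^esub> v\<close>, and \<open>out_degree G u\<close> is the degree of \<open>u\<close>.
  The library predicate \<open>connected\<close> already excludes the graph without vertices.
\<close>

subsection \<open>GDP-trees\<close>

definition cut_vertex :: "('a,'b) pre_digraph \<Rightarrow> 'a \<Rightarrow> bool" where
  "cut_vertex H v \<longleftrightarrow> v \<in> verts H \<and>
     (\<exists>a \<in> verts H - {v}. \<exists>b \<in> verts H - {v}.
        a \<rightarrow>\<^sup>*\<^bsub>H\<^esub> b \<and> \<not> a \<rightarrow>\<^sup>*\<^bsub>pre_digraph.del_vert H v\<^esub> b)"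

text \<open>
  \<open>subgraph\<close> refers to digraphs, so a subgraph of a graph need not be symmetric;
  hence the conjunct \<open>graph H\<close>.
\<close>

definition block :: "('a,'b) pre_digraph \<Rightarrow> ('a,'b) pre_digraph \<Rightarrow> bool" where
  "block G B \<longleftrightarrow> pre_digraph.max_subgraph G
     (\<lambda>H. graph H \<and> connected H \<and> (\<forall>v. \<not> cut_vertex H v)) B"

definition complete_graph :: "('a,'b) pre_digraph \<Rightarrow> bool" where
  "complete_graph H \<longleftrightarrow> (\<exists>n. K\<^bsub>n\<^esub> H)"

definition cycle_graph :: "('a,'b) pre_digraph \<Rightarrow> bool" where
  "cycle_graph H \<longleftrightarrow> graph H \<and>
     (\<exists>xs. distinct xs \<and> length xs \<ge> 3 \<and> verts H = set xs \<and>
        arcs_ends H =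
          (\<Union>i<length xs. {(xs ! i, xs ! (Suc i mod length xs)),
                          (xs ! (Suc i mod length xs), xs ! i)}))"

definition GDP_tree :: "('a,'b) pre_digraph \<Rightarrow> bool" where
  "GDP_tree G \<longleftrightarrow> graph G \<and> connected G \<and>
     (\<forall>B. block G B \<longrightarrow> complete_graph B \<or> cycle_graph B)"

subsection \<open>Weak degeneracy\<close>

text \<open>
  A function on \<open>V(G)\<close> is represented by a total integer-valued function whose values outside
  \<open>verts G\<close> are irrelevant.
\<close>

definition nonneg_on :: "('a,'b) pre_digraph \<Rightarrow> ('a \<Rightarrow> int) \<Rightarrow> bool" where
  "nonneg_on G f \<longleftrightarrow> (\<forall>v \<in> verts G. 0 \<le> f v)"

definition Delete_fun :: "('a,'b) pre_digraph \<Rightarrow> ('a \<Rightarrow> int) \<Rightarrow> 'a \<Rightarrow> 'a \<Rightarrow> int" where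
  "Delete_fun G f u = (\<lambda>v. if u \<rightarrow>\<^bsub>G\<^esub> v then f v - 1 else f v)"

definition DelSave_fun :: "('a,'b) pre_digraph \<Rightarrow> ('a \<Rightarrow> int) \<Rightarrow> 'a \<Rightarrow> 'a \<Rightarrow> 'a \<Rightarrow> int" where
  "DelSave_fun G f u w = (\<lambda>v. if u \<rightarrow>\<^bsub>G\<^esub> v \<and> v \<noteq> w then f v - 1 else f v)"

inductive removable :: "('a,'b) pre_digraph \<Rightarrow> ('a \<Rightarrow> int) \<Rightarrow> bool" where
  Empty: "verts G = {} \<Longrightarrow> removable G f"
| Delete: "\<lbrakk>u \<in> verts G;
     nonneg_on (pre_digraph.del_vert G u) (Delete_fun G f u);
     removable (pre_digraph.del_vert G u) (Delete_fun G f u)\<rbrakk> \<Longrightarrow> removable G f"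
| DelSave: "\<lbrakk>u \<in> verts G; w \<in> verts G; u \<rightarrow>\<^bsub>G\<^esub> w; f u > f w;
     nonneg_on (pre_digraph.del_vert G u) (DelSave_fun G f u w);
     removable (pre_digraph.del_vert G u) (DelSave_fun G f u w)\<rbrakk> \<Longrightarrow> removable G f"

text \<open>
  The first conjunct is the convention that a function with a negative value never admits
  a removal sequence; this matters for \<open>deg - 1\<close> on the one-vertex graph.
\<close>

definition weakly_degenerate :: "('a,'b) pre_digraph \<Rightarrow> ('a \<Rightarrow> int) \<Rightarrow> bool" where
  "weakly_degenerate G f \<longleftrightarrow> nonneg_on G f \<and> removable G f"

end

theory Submission
  imports Defs
begin

text \<open>
  Write \<open>f = deg - 1\<close>. A plain deletion changes values and degrees by the same amount, so the
  question is when a saving removal can create a vertex whose value reaches its degree. Once this happens in a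
  connected graph, all vertices can be deleted towards that vertex (\<open>eliminable_if_surplus\<close>). A saving removal
  of \<open>u\<close> along an edge \<open>uw\<close> needs \<open>deg u > deg w\<close>, and it helps when \<open>u\<close> is not a cut vertex.

  If \<open>G\<close> is a GDP-tree, then all edges at a non-cut vertex \<open>u\<close> lie in one block, which is regular;
  so no neighbour of \<open>u\<close> has smaller degree and nothing can be saved. Removing a cut vertex may spare
  a vertex in one of the resulting components, but another component is again a GDP-tree with the values
  \<open>deg - 1\<close>. By descent some isolated vertex gets the value \<open>-1\<close>. To make this inductive, the condition on
  blocks is relaxed to the hereditary condition that every nonseparable vertex set induces a regular graph
  (\<open>GDP_tree_regular\<close>, \<open>not_eliminable_if_regular_pieces\<close>).

  If \<open>G\<close> has a block \<open>B\<close> that is neither a clique nor a cycle, first delete everything outside \<open>B\<close>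
  (\<open>eliminable_if_subset_eliminable\<close>). If \<open>B\<close> is not regular, some edge of \<open>B\<close> has a degree drop, and \<open>B\<close> has no cut
  vertices. Otherwise \<open>B\<close> is \<open>d\<close>-regular with \<open>d \<ge> 3\<close>, and as in the proof of Brooks' theorem one vertex
  can be deleted so that a degree drop appears at a non-cut vertex
  (\<open>exists_edge_made_irregular_by_deletion\<close>).
\<close>

section \<open>Connectivity of vertex sets\<close>

text \<open>
  The graph-theoretic arguments speak about induced subgraphs only, so they are carried out for
  vertex sets \<open>S\<close> under one fixed adjacency relation \<open>E\<close>: deleting a vertex then changes \<open>S\<close> but
  not \<open>E\<close>. The empty set counts as connected, which makes \<open>S - {v}\<close> harmless for singletons \<open>S\<close>;
  \<open>nonseparable\<close> means connected without cut vertices.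
\<close>

definition linked :: "('a \<times> 'a) set \<Rightarrow> 'a set \<Rightarrow> 'a \<Rightarrow> 'a \<Rightarrow> bool" where
  "linked E S a b \<longleftrightarrow> (a, b) \<in> (E \<inter> S \<times> S)\<^sup>*"

definition connected_on :: "('a \<times> 'a) set \<Rightarrow> 'a set \<Rightarrow> bool" where
  "connected_on E S \<longleftrightarrow> (\<forall>a\<in>S. \<forall>b\<in>S. linked E S a b)"

definition component :: "('a \<times> 'a) set \<Rightarrow> 'a set \<Rightarrow> 'a \<Rightarrow> 'a set" where
  "component E S a = {b \<in> S. linked E S a b}"

definition nonseparable :: "('a \<times> 'a) set \<Rightarrow> 'a set \<Rightarrow> bool" where
  "nonseparable E S \<longleftrightarrow> S \<noteq> {} \<and> connected_on E S \<and> (\<forall>v\<in>S. connected_on E (S - {v}))"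

definition nbrs :: "('a \<times> 'a) set \<Rightarrow> 'a set \<Rightarrow> 'a \<Rightarrow> 'a set" where
  "nbrs E S v = {w \<in> S. (v, w) \<in> E}"

definition deg :: "('a \<times> 'a) set \<Rightarrow> 'a set \<Rightarrow> 'a \<Rightarrow> nat" where
  "deg E S v = card (nbrs E S v)"

definition regular_on :: "('a \<times> 'a) set \<Rightarrow> 'a set \<Rightarrow> bool" where
  "regular_on E S \<longleftrightarrow> (\<forall>a\<in>S. \<forall>b\<in>S. deg E S a = deg E S b)"

definition clique_on :: "('a \<times> 'a) set \<Rightarrow> 'a set \<Rightarrow> bool" where
  "clique_on E S \<longleftrightarrow> (\<forall>a\<in>S. \<forall>b\<in>S. a \<noteq> b \<longrightarrow> (a, b) \<in> E)"

lemma linked_refl [simp, intro]: "linked E S a a"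
  by (simp add: linked_def)

lemma linked_trans [trans]: "linked E S a b \<Longrightarrow> linked E S b c \<Longrightarrow> linked E S a c"
  unfolding linked_def by (rule rtrancl_trans)

lemma linked_edge: "(a, b) \<in> E \<Longrightarrow> a \<in> S \<Longrightarrow> b \<in> S \<Longrightarrow> linked E S a b"
  unfolding linked_def by blast

lemma linked_mono: "linked E S a b \<Longrightarrow> E \<subseteq> F \<Longrightarrow> S \<subseteq> T \<Longrightarrow> linked F T a b"
  unfolding linked_def using rtrancl_mono[of "E \<inter> S \<times> S" "F \<inter> T \<times> T"] by blast

lemma linked_closed:
  assumes "linked E S a b" "a \<in> A" "\<And>x y. x \<in> A \<Longrightarrow> (x, y) \<in> E \<Longrightarrow> x \<in> S \<Longrightarrow> y \<in> S \<Longrightarrow> y \<in> A"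
  shows "b \<in> A"
  using assms(1) unfolding linked_def by (induction rule: rtrancl_induct) (use assms in auto)

lemma linked_in: "linked E S a b \<Longrightarrow> a \<in> S \<Longrightarrow> b \<in> S"
  by (rule linked_closed[where A = S])

lemma connected_on_mono: "connected_on E S \<Longrightarrow> E \<subseteq> F \<Longrightarrow> connected_on F S"
  unfolding connected_on_def by (simp add: linked_mono[of E S _ _ F S])

lemma connected_on_empty [simp]: "connected_on E {}"
  by (simp add: connected_on_def)

lemma connected_on_singleton [simp]: "connected_on E {a}"
  by (simp add: connected_on_def)

text \<open>
  A walk that starts in \<open>A\<close> and ends outside \<open>A\<close> has to leave \<open>A\<close> somewhere. Most arguments below
  choose a property of vertices as \<open>A\<close> and get an edge along which the property changes.
\<close>
lemma boundary_edge:
  assumes "connected_on E S" "a \<in> S" "a \<in> A" "b \<in> S" "b \<notin> A"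
  obtains x y where "x \<in> S" "x \<in> A" "y \<in> S" "y \<notin> A" "(x, y) \<in> E"
  using assms linked_closed[of E S a b A] unfolding connected_on_def by blast

lemma component_subset: "component E S a \<subseteq> S"
  by (auto simp: component_def)

lemma component_self: "a \<in> S \<Longrightarrow> a \<in> component E S a"
  by (simp add: component_def)

lemma component_closed:
  "x \<in> component E S a \<Longrightarrow> (x, y) \<in> E \<Longrightarrow> y \<in> S \<Longrightarrow> y \<in> component E S a"
  unfolding component_def by (auto intro: linked_trans linked_edge)

lemma deg_connected_pos:
  assumes "connected_on E S" "finite S" "a \<in> S" "b \<in> S" "a \<noteq> b"
  shows "deg E S a \<ge> 1"
proof -
  obtain y where "y \<in> S" "(a, y) \<in> E"
    using boundary_edge[OF assms(1), of a "{a}" b] assms(3-5) by blast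
  then have "nbrs E S a \<noteq> {}" "finite (nbrs E S a)"
    using assms(2) by (auto simp: nbrs_def)
  then show ?thesis
    by (simp add: deg_def Suc_leI card_gt_0_iff)
qed

locale adjacency =
  fixes E :: "('a \<times> 'a) set"
  assumes adj_sym: "(a, b) \<in> E \<Longrightarrow> (b, a) \<in> E"
    and adj_irrefl: "(a, a) \<notin> E"
begin

lemma linked_sym: "linked E S a b \<Longrightarrow> linked E S b a"
proof -
  have "sym (E \<inter> S \<times> S)"
    by (auto intro!: symI adj_sym)
  then show "linked E S a b \<Longrightarrow> linked E S b a"
    unfolding linked_def by (blast dest: sym_rtrancl symD)
qed

lemma connected_onI:
  assumes "\<And>a. a \<in> S \<Longrightarrow> linked E S r a"
  shows "connected_on E S"
  unfolding connected_on_def using assms linked_trans linked_sym by metis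

lemma connected_on_Un_edge:
  assumes "connected_on E S" "connected_on E T" "x \<in> S" "y \<in> T" "(x, y) \<in> E"
  shows "connected_on E (S \<union> T)"
proof (rule connected_onI[where r = x])
  fix a assume "a \<in> S \<union> T"
  then consider "a \<in> S" | "a \<in> T" by blast
  then show "linked E (S \<union> T) x a"
  proof cases
    case 1
    then show ?thesis
      using assms linked_mono[of E S x a E "S \<union> T"] by (auto simp: connected_on_def)
  next
    case 2
    then have "linked E (S \<union> T) y a"
      using assms linked_mono[of E T y a E "S \<union> T"] by (auto simp: connected_on_def)
    moreover have "linked E (S \<union> T) x y"
      using assms by (intro linked_edge) auto
    ultimately show ?thesis by (rule linked_trans[rotated])
  qed
qed

lemma connected_on_insert:
  "connected_on E S \<Longrightarrow> x \<in> S \<Longrightarrow> (x, y) \<in> E \<Longrightarrow> connected_on E (insert y S)"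
  using connected_on_Un_edge[of S "{y}" x y] by simp

lemma connected_component: "connected_on E (component E S a)"
proof (cases "a \<in> S")
  case True
  show ?thesis
  proof (rule connected_onI[where r = a])
    fix b assume "b \<in> component E S a"
    then have "linked E S a b" by (simp add: component_def)
    have "b \<in> {b. linked E (component E S a) a b}"
    proof (rule linked_closed[OF \<open>linked E S a b\<close>])
      fix x y assume *: "x \<in> {b. linked E (component E S a) a b}" "(x, y) \<in> E" "x \<in> S" "y \<in> S"
      then have x: "x \<in> component E S a"
        using linked_in component_self[OF True] by (metis mem_Collect_eq)
      then have "y \<in> component E S a"
        using * component_closed by metis
      then show "y \<in> {b. linked E (component E S a) a b}"
        using * x linked_edge linked_trans by (metis mem_Collect_eq)
    qed simp
    then show "linked E (component E S a) a b" by simp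
  qed
next
  case False
  then have "component E S a = {}"
    unfolding component_def using linked_in[OF linked_sym, of S a] by blast
  then show ?thesis by simp
qed

lemma component_disjoint:
  "\<not> linked E S a b \<Longrightarrow> component E S a \<inter> component E S b = {}"
  using linked_trans[OF _ linked_sym, of S a _ b] unfolding component_def by blast

lemma connected_insert_component:
  assumes "connected_on E T" "t \<in> T" "y \<in> T - {t}"
  shows "connected_on E (insert t (component E (T - {t}) y))"
proof -
  let ?D = "component E (T - {t}) y"
  obtain x z where xz: "x \<in> T" "x \<in> ?D" "z \<in> T" "z \<notin> ?D" "(x, z) \<in> E"
    using boundary_edge[OF assms(1), of y ?D t] assms component_self[of y "T - {t}" E]
      component_subset[of E "T - {t}" y] by blast
  have "z = t"
    using component_closed[of x E "T - {t}" y z] xz by blast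
  then show ?thesis
    using connected_on_insert[OF connected_component xz(2)] xz by blast
qed

text \<open>
  The components of \<open>T - {t}\<close> hang together only through \<open>t\<close>, so each of the others stays
  attached to \<open>t\<close> when one of them is discarded.
\<close>
lemma connected_minus_component:
  assumes "connected_on E T" "t \<in> T"
  shows "connected_on E (T - component E (T - {t}) a)"
proof (rule connected_onI[where r = t])
  let ?C = "component E (T - {t}) a"
  fix y assume y: "y \<in> T - ?C"
  show "linked E (T - ?C) t y"
  proof (cases "y = t")
    case False
    let ?D = "component E (T - {t}) y"
    have "\<not> linked E (T - {t}) a y"
      using y False by (auto simp: component_def)
    then have "insert t ?D \<subseteq> T - ?C"
      using component_disjoint[of "T - {t}" a y] component_subset[of E "T - {t}" y]
        component_subset[of E "T - {t}" a] assms(2) by blast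
    moreover have "linked E (insert t ?D) t y"
      using connected_insert_component[OF assms, of y] component_self[of y "T - {t}" E] y False
      unfolding connected_on_def by blast
    ultimately show ?thesis
      using linked_mono[OF _ order_refl] by metis
  qed simp
qed

text \<open>
  Grow \<open>B\<close> inside \<open>V\<close> one adjacent vertex at a time; the vertex added last can be removed.
  With \<open>B\<close> a singleton this says that a connected set has a non-cut vertex besides a given one.
\<close>
lemma exists_removable_outside:
  assumes "finite V" "connected_on E V" "B \<subseteq> V" "B \<noteq> V" "B \<noteq> {}" "connected_on E B"
  shows "\<exists>u\<in>V - B. connected_on E (V - {u})"
  using assms(3-)
proof (induction "card (V - B)" arbitrary: B rule: less_induct)
  case less
  obtain a b where "a \<in> B" "b \<in> V - B"
    using less.prems by blast
  then obtain x y where xy: "x \<in> V" "x \<in> B" "y \<in> V" "y \<notin> B" "(x, y) \<in> E"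
    using boundary_edge[OF assms(2), of a B b] less.prems by blast
  have c: "connected_on E (insert y B)"
    using connected_on_insert[of B x y] less.prems xy by blast
  show ?case
  proof (cases "insert y B = V")
    case True
    then have "V - {y} = B" using xy by blast
    then show ?thesis using less.prems xy by auto
  next
    case False
    have "card (V - insert y B) < card (V - B)"
      using xy assms(1) by (intro psubset_card_mono) auto
    then have "\<exists>u\<in>V - insert y B. connected_on E (V - {u})"
      using less.hyps[of "insert y B"] less.prems False xy c by blast
    then show ?thesis by blast
  qed
qed

text \<open>
  A set-based substitute for end blocks: inside every component \<open>C\<close> of \<open>H - {c}\<close> there is a component
  of some \<open>H - {c'}\<close> that contains no cut vertex of \<open>H\<close>. If \<open>v \<in> C\<close> is a cut vertex, then some component of
  \<open>H - {v}\<close> avoids \<open>c\<close>; the connected set \<open>H - C\<close> stays with \<open>c\<close>, so that component lies in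
  \<open>C - {v}\<close> and the search continues there.
\<close>
lemma exists_end_piece:
  assumes "finite H" "connected_on E H" "c \<in> H" "a \<in> H - {c}"
  shows "\<exists>c'\<in>H. \<exists>a'\<in>H - {c'}. component E (H - {c'}) a' \<subseteq> component E (H - {c}) a \<and>
           (\<forall>v\<in>component E (H - {c'}) a'. connected_on E (H - {v}))"
  using assms(3,4)
proof (induction "card (component E (H - {c}) a)" arbitrary: c a rule: less_induct)
  case less
  let ?C = "component E (H - {c}) a"
  show ?case
  proof (cases "\<forall>v\<in>?C. connected_on E (H - {v})")
    case True
    then show ?thesis using less.prems by blast
  next
    case False
    then obtain v where v: "v \<in> ?C" "\<not> connected_on E (H - {v})" by blast
    have vH: "v \<in> H" "v \<noteq> c" using v component_subset[of E "H - {c}" a] by blast+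
    obtain b where b: "b \<in> H - {v}" "\<not> linked E (H - {v}) c b"
      using v(2) connected_onI[of "H - {v}" c] by blast
    let ?K = "component E (H - {v}) b"
    have "x \<notin> ?K" if "x \<in> H - ?C" for x
    proof
      assume "x \<in> ?K"
      have "linked E (H - ?C) c x"
        using connected_minus_component[OF assms(2) less.prems(1), of a] that less.prems
          component_subset[of E "H - {c}" a] unfolding connected_on_def by blast
      then have "linked E (H - {v}) c x"
        by (rule linked_mono) (use v in auto)
      then show False
        using b \<open>x \<in> ?K\<close> linked_trans[OF _ linked_sym, of "H - {v}" c x b]
        unfolding component_def by blast
    qed
    then have KC: "?K \<subseteq> ?C" using component_subset[of E "H - {v}" b] by blast
    moreover have "v \<notin> ?K" using component_subset[of E "H - {v}" b] by blast
    ultimately have "?K \<subset> ?C" using v by blast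
    then have "card ?K < card ?C"
      using assms(1) finite_subset[OF component_subset[of E "H - {c}" a]]
      by (intro psubset_card_mono) auto
    then show ?thesis
      using less.hyps[of v b] b vH KC by (meson subset_trans)
  qed
qed

section \<open>Nonseparable sets\<close>
lemma nonseparable_connected: "nonseparable E S \<Longrightarrow> connected_on E S"
  unfolding nonseparable_def by blast

lemma nonseparableD: "nonseparable E S \<Longrightarrow> connected_on E (S - {v})"
  unfolding nonseparable_def by (cases "v \<in> S") auto

lemma nonseparable_edge:
  assumes "(u, w) \<in> E"
  shows "nonseparable E {u, w}"
proof -
  have "connected_on E {u, w}"
    using connected_on_insert[of "{w}" w u] assms adj_sym by simp
  moreover have "{u, w} - {u} = {w}" "{u, w} - {w} = {u}"
    using assms adj_irrefl by auto
  ultimately show ?thesis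
    by (auto simp: nonseparable_def)
qed

text \<open>
  Deleting \<open>w\<close> isolates \<open>v\<close>, which in a set without cut vertices leaves no room for a third vertex.
\<close>
lemma nonseparable_subset_pair_if_pendant:
  assumes "nonseparable E S" "v \<in> S" "nbrs E S v \<subseteq> {w}"
  shows "S \<subseteq> {v, w}"
proof
  fix x assume x: "x \<in> S"
  show "x \<in> {v, w}"
  proof (rule ccontr)
    assume n: "x \<notin> {v, w}"
    show False
    proof (cases "v = w")
      case False
      then obtain y where "y \<in> S - {w}" "(v, y) \<in> E"
        using boundary_edge[OF nonseparableD[OF assms(1), of w], of v "{v}" x] n x assms(2)
        by blast
      then show False using assms(3) by (auto simp: nbrs_def)
    next
      case True
      then obtain y where "y \<in> S" "(v, y) \<in> E" "y \<noteq> v"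
        using boundary_edge[OF nonseparable_connected[OF assms(1)], of v "{v}" x] n x assms(2)
        by blast
      then show False using assms(3) True by (auto simp: nbrs_def)
    qed
  qed
qed

text \<open>
  A non-cut vertex \<open>u\<close> lies in only one block. If a neighbour \<open>z\<close> of \<open>u\<close> were outside the block \<open>S\<close>, then
  \<open>z\<close> could still reach \<open>S - {u}\<close> without passing through \<open>u\<close>, which gives an ear that enlarges \<open>S\<close>.
  Instead of a path, the ear is a connected set \<open>T\<close> outside \<open>S\<close> that contains \<open>z\<close> and touches \<open>S - {u}\<close>, of
  least cardinality: if deleting \<open>v \<in> T\<close> left a component of \<open>T - {v}\<close> without contact to \<open>S\<close>, that component
  could be discarded from \<open>T\<close>.
\<close>
lemma maximal_nonseparable_absorbs_nbrs:
  assumes "finite V" "connected_on E (V - {u})" "u \<in> V"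
    and S: "S \<subseteq> V" "nonseparable E S" "u \<in> S" "w \<in> S" "w \<noteq> u"
    and max: "\<And>T. S \<subseteq> T \<Longrightarrow> T \<subseteq> V \<Longrightarrow> nonseparable E T \<Longrightarrow> T = S"
  shows "nbrs E V u \<subseteq> S"
proof
  fix z assume "z \<in> nbrs E V u"
  then have z: "z \<in> V" "(u, z) \<in> E" by (auto simp: nbrs_def)
  show "z \<in> S"
  proof (rule ccontr)
    assume "z \<notin> S"
    define ear where "ear T \<longleftrightarrow> T \<subseteq> V - S \<and> z \<in> T \<and> connected_on E T
      \<and> (\<exists>x\<in>T. \<exists>y\<in>S - {u}. (x, y) \<in> E)" for T
    let ?T0 = "component E (V - S) z"
    have z0: "z \<in> ?T0" using z \<open>z \<notin> S\<close> by (simp add: component_self)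
    have "ear ?T0"
    proof -
      obtain x y where xy: "x \<in> V - {u}" "x \<in> ?T0" "y \<in> V - {u}" "y \<notin> ?T0" "(x, y) \<in> E"
      proof (rule boundary_edge[OF assms(2)])
        show "z \<in> V - {u}" using z \<open>z \<notin> S\<close> S(3) by blast
        show "w \<in> V - {u}" using S by blast
        show "w \<notin> ?T0" using S(4) component_subset[of E "V - S" z] by blast
      qed (use z0 in auto)
      have "y \<in> S" using component_closed[OF xy(2,5)] xy by blast
      then show ?thesis
        unfolding ear_def using xy z0
        by (intro conjI connected_component component_subset bexI[of _ x] bexI[of _ y]) auto
    qed
    then obtain T where T: "ear T" and least: "\<And>T'. ear T' \<Longrightarrow> card T \<le> card T'"
      using ex_has_least_nat[of ear ?T0 card] by blast
    have TV: "T \<subseteq> V - S" "finite T"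
      using T assms(1) finite_subset[of T V] unfolding ear_def by auto
    obtain p q where pq: "p \<in> T" "q \<in> S" "q \<noteq> u" "(p, q) \<in> E"
      using T unfolding ear_def by blast
    have zT: "z \<in> T" and cT: "connected_on E T"
      using T unfolding ear_def by auto
    have cS: "connected_on E S"
      using S(2) unfolding nonseparable_def by simp
    \<comment> \<open>\<open>S\<close> and \<open>T\<close> are joined by the edges \<open>uz\<close> and \<open>qp\<close>; since \<open>q \<noteq> u\<close>, deleting a vertex of \<open>S\<close> destroys
      at most one of them.\<close>
    have "connected_on E (S \<union> T - {v})" if "v \<in> S \<union> T" for v
    proof (cases "v \<in> S")
      case True
      have eq: "S \<union> T - {v} = (S - {v}) \<union> T" using True TV by blast
      have c: "connected_on E (S - {v})" using S(2) by (rule nonseparableD)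
      show ?thesis
      proof (cases "v = u")
        case True
        then show ?thesis
          unfolding eq using connected_on_Un_edge[OF c cT, of q p] pq adj_sym by blast
      next
        case False
        then show ?thesis
          unfolding eq using connected_on_Un_edge[OF c cT, of u z] z zT S by blast
      qed
    next
      case False
      then have v: "v \<in> T" using that by blast
      show ?thesis
      proof (rule connected_onI[where r = u])
        fix y assume y: "y \<in> S \<union> T - {v}"
        show "linked E (S \<union> T - {v}) u y"
        proof (cases "y \<in> S")
          case True
          then have "linked E S u y" using cS S by (auto simp: connected_on_def)
          then show ?thesis by (rule linked_mono) (use False in auto)
        next
          case yS: False
          let ?C = "component E (T - {v}) y"
          have yC: "y \<in> ?C" using y yS by (simp add: component_self)
          have CT: "?C \<subseteq> T - {v}" by (rule component_subset)
          have "\<exists>x\<in>?C. \<exists>s\<in>S. (x, s) \<in> E"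
          proof (rule ccontr)
            assume no: "\<not> ?thesis"
            then have "z \<notin> ?C" using z adj_sym S by blast
            moreover have "p \<notin> ?C" using no pq by blast
            ultimately have "ear (T - ?C)"
              unfolding ear_def using connected_minus_component[OF cT v, of y] TV pq zT by blast
            then have "card T \<le> card (T - ?C)" by (rule least)
            moreover have "card (T - ?C) < card T"
              using TV yC CT by (intro psubset_card_mono) auto
            ultimately show False by simp
          qed
          then obtain x s where "s \<in> S" "x \<in> ?C" "(s, x) \<in> E" using adj_sym by blast
          then have "connected_on E (S \<union> ?C)"
            by (rule connected_on_Un_edge[OF cS connected_component])
          then have "linked E (S \<union> ?C) u y"
            using yC S by (auto simp: connected_on_def)
          then show ?thesis
            by (rule linked_mono) (use CT False in auto)
        qed
      qed
    qed
    moreover have "connected_on E (S \<union> T)"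
      using connected_on_Un_edge[OF cS cT] z zT S by blast
    ultimately have "nonseparable E (S \<union> T)"
      using S by (auto simp: nonseparable_def)
    then have "S \<union> T = S"
      using max TV S by blast
    then show False using zT TV by blast
  qed
qed

end

section \<open>Eliminating vertices\<close>

text \<open>
  One operation covers both kinds of removal: \<open>W\<close> is the set of neighbours whose value is spared,
  empty for a plain deletion and a singleton for a saving one.
\<close>
definition lower :: "('a \<times> 'a) set \<Rightarrow> 'a set \<Rightarrow> 'a \<Rightarrow> 'a set \<Rightarrow> ('a \<Rightarrow> int) \<Rightarrow> 'a \<Rightarrow> int" where
  "lower E V u W f = (\<lambda>v. if (u, v) \<in> E \<inter> V \<times> V \<and> v \<notin> W then f v - 1 else f v)"

inductive eliminable :: "('a \<times> 'a) set \<Rightarrow> 'a set \<Rightarrow> ('a \<Rightarrow> int) \<Rightarrow> bool" for E where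
  empty: "eliminable E {} f"
| step: "\<lbrakk>u \<in> V; W = {} \<or> (\<exists>w\<in>V. W = {w} \<and> (u, w) \<in> E \<and> f w < f u);
     \<forall>v\<in>V - {u}. 0 \<le> lower E V u W f v; eliminable E (V - {u}) (lower E V u W f)\<rbrakk>
     \<Longrightarrow> eliminable E V f"

lemma nbrs_mono: "S \<subseteq> T \<Longrightarrow> nbrs E S v \<subseteq> nbrs E T v"
  by (auto simp: nbrs_def)

lemma finite_nbrs [simp]: "finite S \<Longrightarrow> finite (nbrs E S v)"
  by (simp add: nbrs_def)

lemma deg_mono: "S \<subseteq> T \<Longrightarrow> finite T \<Longrightarrow> deg E S v \<le> deg E T v"
  unfolding deg_def by (intro card_mono nbrs_mono finite_nbrs)

lemma deg_remove:
  assumes "finite V" "u \<in> V"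
  shows "deg E V v = deg E (V - {u}) v + (if (v, u) \<in> E then 1 else 0)"
proof (cases "(v, u) \<in> E")
  case True
  then have "nbrs E V v = insert u (nbrs E (V - {u}) v)" "u \<notin> nbrs E (V - {u}) v"
    using assms by (auto simp: nbrs_def)
  then show ?thesis using True assms by (simp add: deg_def)
next
  case False
  then have "nbrs E V v = nbrs E (V - {u}) v"
    by (auto simp: nbrs_def)
  then show ?thesis using False by (simp add: deg_def)
qed

lemma clique_on_regular: "clique_on E S \<Longrightarrow> \<forall>v\<in>S. (v, v) \<notin> E \<Longrightarrow> regular_on E S"
proof -
  assume *: "clique_on E S" "\<forall>v\<in>S. (v, v) \<notin> E"
  have "nbrs E S v = S - {v}" if "v \<in> S" for v
    using * that by (auto simp: nbrs_def clique_on_def)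
  then show ?thesis
    by (simp add: regular_on_def deg_def card_Diff_singleton)
qed

context adjacency begin

text \<open>
  The surplus of the value over the degree is invariant under a plain deletion, and a saving deletion
  raises it by one at the spared vertex. All removal sequences below are controlled through this.
\<close>
lemma lower_minus_deg:
  assumes "finite V" "u \<in> V" "v \<in> V - {u}"
  shows "lower E V u W f v - int (deg E (V - {u}) v) =
    f v - int (deg E V v) + (if (u, v) \<in> E \<and> v \<in> W then 1 else 0)"
  using deg_remove[OF assms(1,2), of E v] assms adj_sym[of u v] adj_sym[of v u]
  by (auto simp: lower_def)

text \<open>
  Once one vertex \<open>r\<close> has a value of at least its degree, delete non-cut vertices other than \<open>r\<close> until only
  \<open>r\<close> is left. The set stays connected, so the other vertices keep positive degrees and no value drops below \<open>0\<close>.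
\<close>
lemma eliminable_if_surplus:
  assumes "finite V" "connected_on E V" "r \<in> V" "int (deg E V r) \<le> f r"
    "\<forall>v\<in>V. int (deg E V v) - 1 \<le> f v"
  shows "eliminable E V f"
  using assms
proof (induction "card V" arbitrary: V f rule: less_induct)
  case less
  show ?case
  proof (cases "V = {r}")
    case True
    then have "V - {r} = {}" by simp
    have "eliminable E (V - {r}) (lower E V r {} f)" "\<forall>v\<in>V - {r}. 0 \<le> lower E V r {} f v"
      unfolding \<open>V - {r} = {}\<close> by (simp_all add: eliminable.empty)
    then show ?thesis
      using eliminable.step[of r V "{}" E f] less.prems(3) by blast
  next
    case False
    then obtain u where u: "u \<in> V" "u \<noteq> r" and c: "connected_on E (V - {u})"
      using exists_removable_outside[OF less.prems(1,2), of "{r}"] less.prems by auto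
    let ?f = "lower E V u {} f"
    have sl: "?f v - int (deg E (V - {u}) v) = f v - int (deg E V v)" if "v \<in> V - {u}" for v
      using lower_minus_deg[OF less.prems(1) u(1) that, of "{}" f] by simp
    have r: "int (deg E (V - {u}) r) \<le> ?f r"
      using sl[of r] u less.prems by simp
    have all: "\<forall>v\<in>V - {u}. int (deg E (V - {u}) v) - 1 \<le> ?f v"
      using sl less.prems(5) by fastforce
    have "0 \<le> ?f v" if "v \<in> V - {u}" for v
    proof (cases "v = r")
      case False
      then have "1 \<le> deg E (V - {u}) v"
        using deg_connected_pos[OF c, of v r] that u less.prems by auto
      then show ?thesis using bspec[OF all that] by linarith
    qed (use r in simp)
    moreover have "eliminable E (V - {u}) ?f"
      by (rule less.hyps)
        (use less.prems u c r all card_Diff1_less[of V u] in auto)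
    ultimately show ?thesis
      using u eliminable.step[of u V "{}" E f] by blast
  qed
qed

text \<open>
  The degree drop is what permits the saving removal of \<open>u\<close> along \<open>uw\<close>. The rest remains connected, and
  the spared vertex \<open>w\<close>, having lost the neighbour \<open>u\<close>, now has a value equal to its degree.
\<close>
lemma eliminable_if_degree_drop:
  assumes "finite V" "u \<in> V" "w \<in> V" "(u, w) \<in> E" "deg E V w < deg E V u"
    "connected_on E (V - {u})" "\<forall>v\<in>V. f v = int (deg E V v) - 1"
  shows "eliminable E V f"
proof -
  let ?f = "lower E V u {w} f"
  have wu: "w \<noteq> u" using assms adj_irrefl by auto
  have sl: "?f v = int (deg E (V - {u}) v) + (if v = w then 0 else - 1)" if "v \<in> V - {u}" for v
    using lower_minus_deg[OF assms(1,2) that, of "{w}" f] assms that by auto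
  have "0 \<le> ?f v" if "v \<in> V - {u}" for v
    using sl[OF that] deg_connected_pos[OF assms(6), of v w] that wu assms by (cases "v = w") auto
  moreover have "eliminable E (V - {u}) ?f"
    by (rule eliminable_if_surplus[where r = w]) (use sl assms wu in auto)
  ultimately show ?thesis
    using assms eliminable.step[of u V "{w}" E f] by auto
qed

text \<open>
  Deleting the vertices outside \<open>B\<close>, always keeping the rest connected, keeps the values equal to \<open>deg - 1\<close>
  and hence reduces the problem for \<open>V\<close> to the one for \<open>B\<close>. If \<open>B\<close> were a singleton, the last deletion would
  leave a negative value.
\<close>
lemma eliminable_if_subset_eliminable:
  assumes "finite V" "connected_on E V" "B \<subseteq> V" "connected_on E B" "2 \<le> card B"
    and B: "\<And>g. \<forall>v\<in>B. g v = int (deg E B v) - 1 \<Longrightarrow> eliminable E B g"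
    and "\<forall>v\<in>V. f v = int (deg E V v) - 1"
  shows "eliminable E V f"
  using assms(1-3,7)
proof (induction "card V" arbitrary: V f rule: less_induct)
  case less
  show ?case
  proof (cases "B = V")
    case True
    then show ?thesis using B less.prems by blast
  next
    case False
    have ne: "B \<noteq> {}" using assms(5) by auto
    then obtain u where u: "u \<in> V" "u \<notin> B" and c: "connected_on E (V - {u})"
      using exists_removable_outside[OF less.prems(1-3) False _ assms(4)] by blast
    let ?f = "lower E V u {} f"
    have sl: "?f v = int (deg E (V - {u}) v) - 1" if "v \<in> V - {u}" for v
      using lower_minus_deg[OF less.prems(1) u(1) that, of "{}" f] less.prems(4) that by auto
    have "0 \<le> ?f v" if v: "v \<in> V - {u}" for v
    proof -
      have "\<not> B \<subseteq> {v}"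
        using assms(5) card_mono[of "{v}" B] by auto
      then obtain y where "y \<in> B" "y \<noteq> v" by blast
      then show ?thesis
        using sl[OF v] deg_connected_pos[OF c, of v y] v u less.prems by fastforce
    qed
    moreover have "eliminable E (V - {u}) ?f"
      by (rule less.hyps) (use less.prems u c sl card_Diff1_less[of V u] in auto)
    ultimately show ?thesis
      using u eliminable.step[of u V "{}" E f] by blast
  qed
qed

section \<open>Nonseparable sets that can be eliminated\<close>
lemma eliminable_irregular:
  assumes "finite B" "nonseparable E B" "\<not> regular_on E B" "\<forall>v\<in>B. f v = int (deg E B v) - 1"
  shows "eliminable E B f"
proof -
  obtain a b where ab: "a \<in> B" "b \<in> B" "deg E B a \<noteq> deg E B b"
    using assms(3) by (auto simp: regular_on_def)
  obtain x y where "x \<in> B" "x \<in> {v. deg E B v = deg E B a}" "y \<in> B"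
      "y \<notin> {v. deg E B v = deg E B a}" "(x, y) \<in> E"
    by (rule boundary_edge[OF nonseparable_connected[OF assms(2)], of a "{v. deg E B v = deg E B a}" b])
      (use ab in auto)
  then have xy: "x \<in> B" "y \<in> B" "deg E B x \<noteq> deg E B y" "(x, y) \<in> E"
    by auto
  show ?thesis
  proof (cases "deg E B x < deg E B y")
    case True
    then show ?thesis
      using eliminable_if_degree_drop[of B y x] nonseparableD[OF assms(2)] xy adj_sym assms by blast
  next
    case False
    then have "deg E B y < deg E B x" using xy by simp
    then show ?thesis
      using eliminable_if_degree_drop[of B x y] nonseparableD[OF assms(2)] xy assms by blast
  qed
qed

text \<open>
  In a \<open>d\<close>-regular set with \<open>d \<ge> 3\<close> some vertex \<open>u\<close> can be deleted to create a degree drop along an edge \<open>xy\<close> at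
  a non-cut vertex \<open>x\<close>. Choose \<open>u\<close> with a non-neighbour and put \<open>H = B - {u}\<close>. If \<open>H\<close> has no cut vertex, any
  edge of \<open>H\<close> between a neighbour and a non-neighbour of \<open>u\<close> will do. Otherwise \<open>H\<close> has two disjoint end pieces.
  Each contains a neighbour of \<open>u\<close>, since its cut vertex does not cut \<open>B\<close>; if neither contains a suitable edge,
  both consist of neighbours of \<open>u\<close> only. A vertex of an end piece has its \<open>d\<close> neighbours in the piece, apart from
  \<open>u\<close> and the cut vertex, so each piece has at least \<open>d - 1\<close> vertices. Then \<open>u\<close> has at least \<open>2 (d - 1)\<close>
  neighbours, which exceeds \<open>d\<close>.
\<close>
lemma exists_edge_made_irregular_by_deletion:
  assumes "finite B" "nonseparable E B" "\<not> clique_on E B"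
    "\<forall>v\<in>B. deg E B v = d" "3 \<le> d"
  shows "\<exists>u\<in>B. \<exists>x\<in>B - {u}. \<exists>y\<in>B - {u}. (x, y) \<in> E \<and> (u, x) \<notin> E \<and> (u, y) \<in> E \<and>
    connected_on E (B - {u} - {x})"
proof (rule ccontr)
  assume neg: "\<not> ?thesis"
  obtain u z where uz: "u \<in> B" "z \<in> B" "u \<noteq> z" "(u, z) \<notin> E"
    using assms(3) by (auto simp: clique_on_def)
  let ?H = "B - {u}"
  have none: "\<not> ((x, y) \<in> E \<and> (u, x) \<notin> E \<and> (u, y) \<in> E \<and> connected_on E (?H - {x}))"
    if "x \<in> ?H" "y \<in> ?H" for x y
    using neg uz that by blast
  have cH: "connected_on E ?H" using nonseparableD[OF assms(2)] .
  have fH: "finite ?H" using assms by simp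
  have "nbrs E B u \<noteq> {}"
    using assms uz by (auto simp: deg_def)
  then obtain t where t: "t \<in> ?H" "(u, t) \<in> E"
    using adj_irrefl by (auto simp: nbrs_def)
  \<comment> \<open>Without cut vertices in \<open>?H\<close>, every boundary edge of the neighbourhood of \<open>u\<close> is suitable.\<close>
  have "\<exists>c\<in>?H. \<not> connected_on E (?H - {c})"
  proof (rule ccontr)
    assume all: "\<not> ?thesis"
    obtain y x where "y \<in> ?H" "y \<in> {v. (u, v) \<in> E}" "x \<in> ?H" "x \<notin> {v. (u, v) \<in> E}"
        "(y, x) \<in> E"
      by (rule boundary_edge[OF cH, of t "{v. (u, v) \<in> E}" z]) (use t uz in auto)
    then show False using none[of x y] all adj_sym by blast
  qed
  then obtain c a b where c: "c \<in> ?H" and ab: "a \<in> ?H - {c}" "b \<in> ?H - {c}"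
      "\<not> linked E (?H - {c}) a b"
    unfolding connected_on_def by blast
  have piece: "\<exists>K \<subseteq> component E (?H - {c}) a. K \<subseteq> nbrs E B u \<and> d \<le> card K + 1"
    if a: "a \<in> ?H - {c}" for a
  proof -
    obtain c' a' where c': "c' \<in> ?H" "a' \<in> ?H - {c'}"
      and sub: "component E (?H - {c'}) a' \<subseteq> component E (?H - {c}) a"
      and nc: "\<And>v. v \<in> component E (?H - {c'}) a' \<Longrightarrow> connected_on E (?H - {v})"
      using exists_end_piece[OF fH cH c a] by blast
    let ?K = "component E (?H - {c'}) a'"
    have KH: "?K \<subseteq> ?H - {c'}" by (rule component_subset)
    have a'K: "a' \<in> ?K" using c'(2) by (rule component_self)
    obtain x y where xy: "x \<in> B - {c'}" "x \<in> ?K" "y \<in> B - {c'}" "y \<notin> ?K" "(x, y) \<in> E"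
    proof (rule boundary_edge[OF nonseparableD[OF assms(2), of c'], of a' ?K u])
      show "a' \<in> B - {c'}" "a' \<in> ?K" using a'K KH by blast+
      show "u \<in> B - {c'}" "u \<notin> ?K" using uz c' KH by blast+
    qed
    have "y = u"
      using component_closed[OF xy(2,5)] xy(3,4) by blast
    then have ux: "(u, x) \<in> E" using xy adj_sym by blast
    \<comment> \<open>Otherwise the connected piece contains an edge between a neighbour and a non-neighbour of \<open>u\<close>.\<close>
    have Ku: "?K \<subseteq> nbrs E B u"
    proof (rule ccontr)
      assume "\<not> ?thesis"
      then obtain s where s: "s \<in> ?K" "(u, s) \<notin> E"
        using KH by (auto simp: nbrs_def)
      obtain p q where "p \<in> ?K" "p \<in> {v. (u, v) \<in> E}" "q \<in> ?K" "q \<notin> {v. (u, v) \<in> E}"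
          "(p, q) \<in> E"
        by (rule boundary_edge[OF connected_component, of x "?H - {c'}" a' "{v. (u, v) \<in> E}" s])
          (use xy(2) ux s in auto)
      then show False
        using none[of q p] nc[of q] KH adj_sym by blast
    qed
    have "nbrs E B a' \<subseteq> insert u (insert c' (?K - {a'}))"
      using component_closed[OF a'K] adj_irrefl by (auto simp: nbrs_def)
    moreover have fK: "finite ?K" using finite_subset[OF KH] fH by blast
    ultimately have "card (nbrs E B a') \<le> card (insert u (insert c' (?K - {a'})))"
      by (intro card_mono) auto
    also have "\<dots> \<le> Suc (Suc (card (?K - {a'})))"
      using fK by (simp add: card_insert_if del: card_Diff_insert)
    also have "\<dots> = Suc (card ?K)"
      using a'K fK by (metis card_Suc_Diff1)
    finally have "d \<le> card ?K + 1"
      using assms(4) c' by (auto simp: deg_def)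
    then show ?thesis using Ku sub by blast
  qed
  obtain K L where K: "K \<subseteq> component E (?H - {c}) a" "K \<subseteq> nbrs E B u" "d \<le> card K + 1"
    and L: "L \<subseteq> component E (?H - {c}) b" "L \<subseteq> nbrs E B u" "d \<le> card L + 1"
    using piece[OF ab(1)] piece[OF ab(2)] by blast
  have fin: "finite (nbrs E B u)" using assms by simp
  have "K \<inter> L = {}"
    using component_disjoint[OF ab(3)] K L by blast
  then have "card K + card L = card (K \<union> L)"
    using K L fin by (metis card_Un_disjoint finite_subset)
  also have "\<dots> \<le> card (nbrs E B u)"
    using K L fin by (intro card_mono) auto
  also have "\<dots> = d"
    using assms(4) uz by (auto simp: deg_def)
  finally show False using K L assms(5) by linarith
qed

lemma eliminable_regular_nonclique:
  assumes "finite B" "nonseparable E B" "\<not> clique_on E B"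
    "\<forall>v\<in>B. deg E B v = d" "3 \<le> d" "\<forall>v\<in>B. f v = int (deg E B v) - 1"
  shows "eliminable E B f"
proof -
  obtain u x y where u: "u \<in> B" and x: "x \<in> B - {u}" and y: "y \<in> B - {u}"
    and e: "(x, y) \<in> E" "(u, x) \<notin> E" "(u, y) \<in> E" and c: "connected_on E (B - {u} - {x})"
    using exists_edge_made_irregular_by_deletion[OF assms(1-5)] by blast
  let ?f = "lower E B u {} f"
  have sl: "?f v = int (deg E (B - {u}) v) - 1" if "v \<in> B - {u}" for v
    using lower_minus_deg[OF assms(1) u that, of "{}" f] assms(6) that by auto
  have dr: "deg E B v = deg E (B - {u}) v + (if (v, u) \<in> E then 1 else 0)" for v
    by (rule deg_remove[OF assms(1) u])
  have "deg E (B - {u}) y < deg E (B - {u}) x"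
    using dr[of x] dr[of y] e adj_sym assms(4) x y by (auto split: if_splits)
  then have "eliminable E (B - {u}) ?f"
    using eliminable_if_degree_drop[of "B - {u}" x y ?f] x y e c sl assms(1) by blast
  moreover have "0 \<le> ?f v" if "v \<in> B - {u}" for v
    using sl[OF that] dr[of v] assms(4,5) that by (auto split: if_splits)
  ultimately show ?thesis
    using u eliminable.step[of u B "{}" E f] by blast
qed

section \<open>Sets that cannot be eliminated\<close>
lemma exists_maximal_nonseparable:
  assumes "finite V" "S \<subseteq> V" "nonseparable E S"
  shows "\<exists>T. S \<subseteq> T \<and> T \<subseteq> V \<and> nonseparable E T \<and>
    (\<forall>T'. T \<subseteq> T' \<longrightarrow> T' \<subseteq> V \<longrightarrow> nonseparable E T' \<longrightarrow> T' = T)"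
proof -
  let ?A = "{T. S \<subseteq> T \<and> T \<subseteq> V \<and> nonseparable E T}"
  have "finite ?A" using assms(1) by (intro finite_subset[of ?A "Pow V"]) auto
  moreover have "S \<in> ?A" using assms by simp
  ultimately have "\<exists>T\<in>?A. S \<subseteq> T \<and> (\<forall>T'\<in>?A. T \<subseteq> T' \<longrightarrow> T = T')"
    by (rule finite_has_maximal2)
  then obtain T where T: "T \<in> ?A" "\<forall>T'\<in>?A. T \<subseteq> T' \<longrightarrow> T = T'"
    by (elim bexE conjE)
  have "T' = T" if "T \<subseteq> T'" "T' \<subseteq> V" "nonseparable E T'" for T'
  proof -
    have "T' \<in> ?A" using T(1) that by auto
    then have "T = T'" using T(2) that(1) by blast
    then show ?thesis by simp
  qed
  then show ?thesis using T(1) by (intro exI[of _ T]) simp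
qed

text \<open>
  All edges at a non-cut vertex \<open>u\<close> lie in one block, where all degrees agree; a neighbour \<open>w\<close> may have further
  edges in other blocks. Hence no saving removal of \<open>u\<close> is legal for the values \<open>deg - 1\<close>.
\<close>
lemma deg_non_cut_le_deg_nbr:
  assumes "finite H" "u \<in> H" "w \<in> H" "(u, w) \<in> E" "connected_on E (H - {u})"
    and reg: "\<And>S. S \<subseteq> H \<Longrightarrow> nonseparable E S \<Longrightarrow> regular_on E S"
  shows "deg E H u \<le> deg E H w"
proof -
  obtain S where S: "{u, w} \<subseteq> S" "S \<subseteq> H" "nonseparable E S"
    and max: "\<And>T. S \<subseteq> T \<Longrightarrow> T \<subseteq> H \<Longrightarrow> nonseparable E T \<Longrightarrow> T = S"
    using exists_maximal_nonseparable[OF assms(1) _ nonseparable_edge[OF assms(4)]] assms by blast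
  have "nbrs E H u \<subseteq> S"
    using maximal_nonseparable_absorbs_nbrs[OF assms(1,5,2) S(2,3), of w] max S assms(4) adj_irrefl
    by blast
  then have "nbrs E H u = nbrs E S u"
    using S by (auto simp: nbrs_def)
  then have "deg E H u = deg E S u" by (simp add: deg_def)
  also have "\<dots> = deg E S w"
    using reg[OF S(2,3)] S(1) by (auto simp: regular_on_def)
  also have "\<dots> \<le> deg E H w"
    using deg_mono[OF S(2) assms(1)] .
  finally show ?thesis .
qed

text \<open>
  The hypotheses on the component \<open>H\<close> of \<open>V\<close> pass to a smaller set whenever a vertex \<open>u\<close> of \<open>H\<close> is removed: at most
  one neighbour of \<open>u\<close> is spared, and a component \<open>K\<close> of \<open>H - {u}\<close> without a spared vertex again carries the values
  \<open>deg - 1\<close>. If \<open>u\<close> is a cut vertex of \<open>H\<close>, one of two components is such a \<open>K\<close>; if not, nothing can be spared and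
  \<open>H - {u}\<close> is taken. The descent ends with an isolated vertex, whose value would be \<open>-1\<close>. Regularity of all
  nonseparable subsets is used in place of the shape of the blocks because it is trivially hereditary.
\<close>
lemma not_eliminable_if_regular_pieces:
  assumes "eliminable E V f" "finite V" "\<forall>v\<in>V. 0 \<le> f v"
    and "H \<subseteq> V" "H \<noteq> {}" "connected_on E H" "\<And>x y. x \<in> H \<Longrightarrow> (x, y) \<in> E \<Longrightarrow> y \<in> V \<Longrightarrow> y \<in> H"
    and "\<And>v. v \<in> H \<Longrightarrow> f v = int (deg E H v) - 1"
    and "\<And>S. S \<subseteq> H \<Longrightarrow> nonseparable E S \<Longrightarrow> regular_on E S"
  shows False
  using assms
proof (induction arbitrary: H rule: eliminable.induct)
  case (empty f)
  then show ?case by blast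
next
  case (step u V W f)
  let ?f = "lower E V u W f"
  have fin: "finite H" "finite (V - {u})" using step.prems(1) finite_subset[OF step.prems(3)] by auto
  show ?case
  proof (cases "u \<in> H")
    case False
    have f: "?f v = f v" if "v \<in> H" for v
      using step.prems(6)[of v u] that False step.hyps(1) adj_sym by (auto simp: lower_def)
    show ?thesis
    proof (rule step.IH[where H = H])
      show "H \<subseteq> V - {u}" using False step.prems(3) by blast
      show "?f v = int (deg E H v) - 1" if "v \<in> H" for v
        using f[OF that] step.prems(7)[OF that] by simp
    qed (use step.prems step.hyps fin in blast)+
  next
    case True
    \<comment> \<open>The value of an isolated vertex would be \<open>-1\<close>.\<close>
    have ne: "H \<noteq> {u}"
    proof
      assume "H = {u}"
      then have "nbrs E H u = {}" using adj_irrefl by (auto simp: nbrs_def)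
      then have "f u = - 1" using step.prems(7)[OF True] by (simp add: deg_def)
      then show False using step.prems(2) step.hyps(1) by fastforce
    qed
    obtain K where K: "K \<subseteq> H - {u}" "K \<noteq> {}" "connected_on E K" "K \<inter> W = {}"
      and cl: "\<And>x y. x \<in> K \<Longrightarrow> (x, y) \<in> E \<Longrightarrow> y \<in> H - {u} \<Longrightarrow> y \<in> K"
    proof (cases "connected_on E (H - {u})")
      case c: True
      have "W = {}"
      proof (rule ccontr)
        assume "W \<noteq> {}"
        then obtain w where w: "w \<in> V" "(u, w) \<in> E" "f w < f u"
          using step.hyps(2) by blast
        then have "w \<in> H" using step.prems(6) True by blast
        then have "deg E H w < deg E H u"
          using w step.prems(7) True by fastforce
        moreover have "deg E H u \<le> deg E H w"
          by (rule deg_non_cut_le_deg_nbr) (use fin True \<open>w \<in> H\<close> w c step.prems(8) in auto)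
        ultimately show False by simp
      qed
      then show ?thesis using that[of "H - {u}"] c ne step.prems(4) by blast
    next
      case False
      then obtain a b where ab: "a \<in> H - {u}" "b \<in> H - {u}" "\<not> linked E (H - {u}) a b"
        unfolding connected_on_def by blast
      have "component E (H - {u}) a \<inter> component E (H - {u}) b = {}"
        by (rule component_disjoint[OF ab(3)])
      moreover have "W = {} \<or> (\<exists>w. W = {w})" using step.hyps(2) by blast
      ultimately obtain k where k: "k \<in> H - {u}" "component E (H - {u}) k \<inter> W = {}"
        using ab by (cases "component E (H - {u}) a \<inter> W = {}") auto
      show ?thesis
      proof (rule that)
        show "component E (H - {u}) k \<noteq> {}" using component_self[OF k(1)] by blast
      qed (use k component_subset connected_component component_closed in metis)+
    qed
    show ?thesis
    proof (rule step.IH[where H = K])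
      show "K \<subseteq> V - {u}" using K step.prems(3) by blast
      show "y \<in> K" if "x \<in> K" "(x, y) \<in> E" "y \<in> V - {u}" for x y
        using that cl[OF that(1,2)] step.prems(6)[of x y] K by blast
      show "?f v = int (deg E K v) - 1" if v: "v \<in> K" for v
      proof -
        have "nbrs E K v = nbrs E (H - {u}) v"
          using cl v K by (auto simp: nbrs_def)
        then have "deg E K v = deg E (H - {u}) v" by (simp add: deg_def)
        moreover have "deg E H v = deg E (H - {u}) v + (if (v, u) \<in> E then 1 else 0)"
          by (rule deg_remove[OF fin(1) True])
        moreover have "?f v = f v - (if (v, u) \<in> E then 1 else 0)"
          using v K step.hyps(1) step.prems(3) adj_sym[of u v] adj_sym[of v u] by (auto simp: lower_def)
        moreover have "f v = int (deg E H v) - 1"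
          using step.prems(7) v K by blast
        ultimately show ?thesis by simp
      qed
      show "regular_on E S" if "S \<subseteq> K" "nonseparable E S" for S
        using step.prems(8)[of S] that K by blast
    qed (use step.prems step.hyps fin K in auto)
  qed
qed

end

section \<open>Cycles\<close>
definition cycle_on :: "('a \<times> 'a) set \<Rightarrow> 'a set \<Rightarrow> bool" where
  "cycle_on E S \<longleftrightarrow> (\<exists>xs. distinct xs \<and> 3 \<le> length xs \<and> S = set xs \<and>
     E \<inter> S \<times> S = (\<Union>i<length xs. {(xs ! i, xs ! (Suc i mod length xs)),
                               (xs ! (Suc i mod length xs), xs ! i)}))"

lemma deg_cycle_on:
  assumes "cycle_on E S" "v \<in> S"
  shows "deg E S v \<le> 2"
proof -
  obtain xs where xs: "distinct xs" "S = set xs"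
      "E \<inter> S \<times> S = (\<Union>i<length xs. {(xs ! i, xs ! (Suc i mod length xs)),
                                 (xs ! (Suc i mod length xs), xs ! i)})"
    using assms(1) unfolding cycle_on_def by blast
  let ?n = "length xs"
  obtain i where i: "i < ?n" "v = xs ! i"
    using assms(2) xs(2) by (auto simp: in_set_conv_nth)
  let ?p = "if i = 0 then ?n - 1 else i - 1"
  have "nbrs E S v \<subseteq> {xs ! (Suc i mod ?n), xs ! ?p}"
  proof
    fix y assume "y \<in> nbrs E S v"
    then have "(v, y) \<in> E \<inter> S \<times> S" using assms(2) by (auto simp: nbrs_def)
    then obtain j where j: "j < ?n"
      and "(v, y) \<in> {(xs ! j, xs ! (Suc j mod ?n)), (xs ! (Suc j mod ?n), xs ! j)}"
      unfolding xs(3) by blast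
    then consider "v = xs ! j" "y = xs ! (Suc j mod ?n)" | "v = xs ! (Suc j mod ?n)" "y = xs ! j"
      by blast
    then show "y \<in> {xs ! (Suc i mod ?n), xs ! ?p}"
    proof cases
      case 1
      then have "i = j" using i j xs(1) nth_eq_iff_index_eq by blast
      then show ?thesis using 1 by simp
    next
      case 2
      have "Suc j mod ?n < ?n" by (rule mod_less_divisor) (use j in linarith)
      then have "i = Suc j mod ?n"
        using i 2(1) xs(1) nth_eq_iff_index_eq by metis
      then have "?p = j"
        using j by (cases "Suc j = ?n") auto
      then show ?thesis using 2 by simp
    qed
  qed
  then have "card (nbrs E S v) \<le> card {xs ! (Suc i mod ?n), xs ! ?p}"
    by (intro card_mono) auto
  also have "\<dots> \<le> 2"
    by (simp add: card_insert_if)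
  finally show ?thesis by (simp add: deg_def)
qed

context adjacency begin

lemma nonseparable_le_pair_clique:
  assumes "nonseparable E S" "S \<subseteq> {v, w}"
  shows "clique_on E S"
  unfolding clique_on_def
proof (intro ballI impI)
  fix a b assume ab: "a \<in> S" "b \<in> S" "a \<noteq> b"
  obtain x y where "x \<in> S" "x \<in> {a}" "y \<in> S" "y \<notin> {a}" "(x, y) \<in> E"
    by (rule boundary_edge[OF nonseparable_connected[OF assms(1)], of a "{a}" b]) (use ab in auto)
  moreover then have "y = b" using ab assms(2) by blast
  ultimately show "(a, b) \<in> E" by simp
qed

lemma nonseparable_small_deg_clique:
  assumes "finite S" "nonseparable E S" "v \<in> S" "deg E S v \<le> 1"
  shows "clique_on E S"
proof -
  have "\<exists>w. nbrs E S v \<subseteq> {w}"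
  proof (cases "nbrs E S v = {}")
    case False
    then obtain w where "w \<in> nbrs E S v" by blast
    then show ?thesis
      using assms(1,4) card_le_Suc0_iff_eq[of "nbrs E S v"] by (auto simp: deg_def)
  qed simp
  then obtain w where "nbrs E S v \<subseteq> {w}" ..
  then have "S \<subseteq> {v, w}" using nonseparable_subset_pair_if_pendant assms by blast
  then show ?thesis using nonseparable_le_pair_clique assms by blast
qed

lemma regular_on_if_deg_le_2:
  assumes "finite S" "nonseparable E S" "\<And>v. v \<in> S \<Longrightarrow> deg E S v \<le> 2"
  shows "regular_on E S"
proof (cases "\<forall>v\<in>S. deg E S v = 2")
  case True
  then show ?thesis by (simp add: regular_on_def)
next
  case False
  then obtain v where "v \<in> S" "deg E S v \<noteq> 2" by blast
  then have "deg E S v \<le> 1" using assms(3)[of v] by simp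
  then show ?thesis
    using nonseparable_small_deg_clique[OF assms(1,2) \<open>v \<in> S\<close>] clique_on_regular adj_irrefl by blast
qed

lemma two_regular_nbrs:
  assumes "finite S" "deg E S x = 2" "y \<in> S" "z \<in> S" "(x, y) \<in> E" "(x, z) \<in> E" "y \<noteq> z"
  shows "nbrs E S x = {y, z}"
proof (rule sym, rule card_subset_eq)
  show "{y, z} \<subseteq> nbrs E S x" using assms by (auto simp: nbrs_def)
  show "card {y, z} = card (nbrs E S x)" using assms by (simp add: deg_def)
qed (use assms in simp)

text \<open>
  Take a longest path. All neighbours of its last vertex lie on the path, and the interior vertices have both
  their neighbours next to them, so the path closes up to a cycle; no edge leaves this cycle, and
  connectivity makes it all of \<open>S\<close>.
\<close>
lemma cycle_on_if_two_regular:
  assumes "finite S" "connected_on E S" "S \<noteq> {}" and deg2: "\<And>v. v \<in> S \<Longrightarrow> deg E S v = 2"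
  shows "cycle_on E S"
proof -
  define path where "path xs \<longleftrightarrow> xs \<noteq> [] \<and> distinct xs \<and> set xs \<subseteq> S \<and>
    (\<forall>i. Suc i < length xs \<longrightarrow> (xs ! i, xs ! Suc i) \<in> E)" for xs
  obtain s where "s \<in> S" using assms(3) by blast
  then have "path [s]" by (simp add: path_def)
  moreover have "\<forall>xs. path xs \<longrightarrow> length xs < Suc (card S)"
  proof (intro allI impI)
    fix xs assume "path xs"
    then have "length xs = card (set xs)" "set xs \<subseteq> S"
      by (auto simp: path_def distinct_card)
    then show "length xs < Suc (card S)"
      using card_mono[OF assms(1)] by (simp add: less_Suc_eq_le)
  qed
  ultimately obtain xs where xs: "path xs" and longest: "\<And>ys. path ys \<Longrightarrow> length ys \<le> length xs"
    using ex_has_greatest_nat[of path "[s]" length "Suc (card S)"] by blast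
  let ?n = "length xs"
  let ?l = "xs ! (?n - 1)"
  have ne: "xs \<noteq> []" and dist: "distinct xs" and sub: "set xs \<subseteq> S"
    and edge: "\<And>i. Suc i < ?n \<Longrightarrow> (xs ! i, xs ! Suc i) \<in> E"
    using xs by (auto simp: path_def)
  have inS: "xs ! i \<in> S" if "i < ?n" for i using that sub nth_mem by blast
  have neq: "xs ! i \<noteq> xs ! j" if "i < ?n" "j < ?n" "i \<noteq> j" for i j
    using that dist nth_eq_iff_index_eq by blast
  have lS: "?l \<in> S" using inS ne by simp
  have last_nbrs: "nbrs E S ?l \<subseteq> set xs"
  proof
    fix y assume y: "y \<in> nbrs E S ?l"
    show "y \<in> set xs"
    proof (rule ccontr)
      assume "y \<notin> set xs"
      have "((xs @ [y]) ! i, (xs @ [y]) ! Suc i) \<in> E" if "Suc i < length (xs @ [y])" for i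
      proof (cases "Suc i < ?n")
        case True
        then show ?thesis using edge[of i] by (simp add: nth_append)
      next
        case False
        then have "Suc i = ?n" "i = ?n - 1" using that by simp_all
        then show ?thesis using y by (auto simp: nth_append nbrs_def)
      qed
      then have "path (xs @ [y])"
        using \<open>y \<notin> set xs\<close> y dist sub unfolding path_def by (simp add: nbrs_def)
      then show False using longest[of "xs @ [y]"] by simp
    qed
  qed
  have n3: "3 \<le> ?n"
  proof -
    have "nbrs E S ?l \<subseteq> set xs - {?l}"
      using last_nbrs adj_irrefl by (auto simp: nbrs_def)
    then have "card (nbrs E S ?l) \<le> card (set xs - {?l})"
      by (intro card_mono) auto
    also have "\<dots> = ?n - 1"
      using ne dist by (simp add: distinct_card)
    finally show ?thesis using deg2[OF lS] by (simp add: deg_def)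
  qed
  \<comment> \<open>With degree \<open>2\<close>, an interior vertex of the path has no neighbours besides its predecessor and successor.\<close>
  have inner: "nbrs E S (xs ! i) = {xs ! (i - 1), xs ! Suc i}" if "0 < i" "Suc i < ?n" for i
    using that inS neq[of "i - 1" "Suc i"] edge[of "i - 1"] edge[of i]
    by (intro two_regular_nbrs[OF assms(1) deg2]) (auto intro: adj_sym)
  have "nbrs E S ?l = {xs ! 0, xs ! (?n - 2)}"
  proof (rule card_subset_eq)
    show "nbrs E S ?l \<subseteq> {xs ! 0, xs ! (?n - 2)}"
    proof
      fix y assume y: "y \<in> nbrs E S ?l"
      then have "y \<in> set xs" using last_nbrs by blast
      then obtain j where j: "j < ?n" "y = xs ! j"
        by (auto simp: in_set_conv_nth)
      have yE: "(y, ?l) \<in> E" using y adj_sym by (auto simp: nbrs_def)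
      then have "j \<noteq> ?n - 1" using j adj_irrefl by blast
      moreover have "\<not> (0 < j \<and> j < ?n - 2)"
      proof
        assume that: "0 < j \<and> j < ?n - 2"
        have "?l \<in> nbrs E S (xs ! j)" using yE j lS by (simp add: nbrs_def)
        then have "?l = xs ! (j - 1) \<or> ?l = xs ! Suc j"
          using inner[of j] that by auto
        moreover have "?n - 1 < ?n" "j - 1 < ?n" "Suc j < ?n" "?n - 1 \<noteq> j - 1" "?n - 1 \<noteq> Suc j"
          using that by linarith+
        ultimately show False
          using neq by metis
      qed
      ultimately have "j = 0 \<or> j = ?n - 2" using j by arith
      then show "y \<in> {xs ! 0, xs ! (?n - 2)}" using j by auto
    qed
    have "xs ! 0 \<noteq> xs ! (?n - 2)" by (rule neq) (use n3 in linarith)+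
    then show "card (nbrs E S ?l) = card {xs ! 0, xs ! (?n - 2)}"
      using deg2[OF lS] by (simp add: deg_def)
  qed simp
  then have close: "(?l, xs ! 0) \<in> E" by (auto simp: nbrs_def)
  have suc: "(xs ! i, xs ! (Suc i mod ?n)) \<in> E" if "i < ?n" for i
  proof (cases "Suc i < ?n")
    case False
    then have "Suc i = ?n" using that by simp
    then have "i = ?n - 1" "Suc i mod ?n = 0" by simp_all
    then show ?thesis using close by simp
  qed (use edge in simp)
  \<comment> \<open>Cyclic predecessor of an index.\<close>
  define pred where "pred i = (if i = 0 then ?n - 1 else i - 1)" for i
  have pred: "pred i < ?n" "Suc (pred i) mod ?n = i" if "i < ?n" for i
    using that by (auto simp: pred_def)
  have all_nbrs: "nbrs E S (xs ! i) = {xs ! (Suc i mod ?n), xs ! pred i}" if i: "i < ?n" for i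
  proof (rule two_regular_nbrs[OF assms(1) deg2[OF inS[OF i]]])
    have "Suc i mod ?n < ?n" by (rule mod_less_divisor) (use i in linarith)
    then show "xs ! (Suc i mod ?n) \<in> S" by (rule inS)
    show "xs ! pred i \<in> S" using inS pred i by blast
    show "(xs ! i, xs ! (Suc i mod ?n)) \<in> E" using suc i .
    show "(xs ! i, xs ! pred i) \<in> E" using suc[OF pred(1)[OF i]] pred(2)[OF i] adj_sym by simp
    have "Suc i mod ?n \<noteq> pred i"
      using n3 i by (cases "Suc i = ?n") (auto simp: pred_def)
    then show "xs ! (Suc i mod ?n) \<noteq> xs ! pred i"
      using neq pred(1)[OF i] \<open>Suc i mod ?n < ?n\<close> by blast
  qed
  have S: "S = set xs"
  proof (rule ccontr)
    assume "S \<noteq> set xs"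
    then obtain b where b: "b \<in> S" "b \<notin> set xs" using sub by blast
    obtain x y where xy: "x \<in> S" "x \<in> set xs" "y \<in> S" "y \<notin> set xs" "(x, y) \<in> E"
      by (rule boundary_edge[OF assms(2), of ?l "set xs" b]) (use b lS ne in auto)
    then obtain i where i: "i < ?n" "x = xs ! i" by (auto simp: in_set_conv_nth)
    then have "y \<in> {xs ! (Suc i mod ?n), xs ! pred i}"
      using all_nbrs[of i] xy by (auto simp: nbrs_def)
    moreover have "Suc i mod ?n < ?n" by (rule mod_less_divisor) (use i in linarith)
    then have "xs ! (Suc i mod ?n) \<in> set xs" by (rule nth_mem)
    moreover have "xs ! pred i \<in> set xs" using pred(1)[OF i(1)] by (rule nth_mem)
    ultimately show False
      using xy(4) by blast
  qed
  let ?C = "\<Union>i<?n. {(xs ! i, xs ! (Suc i mod ?n)), (xs ! (Suc i mod ?n), xs ! i)}"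
  have "E \<inter> S \<times> S = ?C"
  proof (intro equalityI subsetI)
    fix e assume e: "e \<in> E \<inter> S \<times> S"
    then obtain i y where i: "i < ?n" "e = (xs ! i, y)" "y \<in> S" "(xs ! i, y) \<in> E"
      using S by (auto simp: in_set_conv_nth)
    then have "y = xs ! (Suc i mod ?n) \<or> y = xs ! pred i"
      using all_nbrs[of i] by (auto simp: nbrs_def)
    then show "e \<in> ?C"
    proof
      assume "y = xs ! (Suc i mod ?n)"
      then show ?thesis using i by blast
    next
      assume "y = xs ! pred i"
      then have "e = (xs ! (Suc (pred i) mod ?n), xs ! pred i)" using i pred by simp
      then show ?thesis using pred(1)[OF i(1)] by blast
    qed
  next
    fix e assume "e \<in> ?C"
    then obtain i where i: "i < ?n"
        "e = (xs ! i, xs ! (Suc i mod ?n)) \<or> e = (xs ! (Suc i mod ?n), xs ! i)"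
      by blast
    have "Suc i mod ?n < ?n" by (rule mod_less_divisor) (use i in linarith)
    then show "e \<in> E \<inter> S \<times> S"
      using i suc[of i] adj_sym inS by auto
  qed
  then show ?thesis
    unfolding cycle_on_def using dist n3 S by (intro exI[of _ xs]) simp
qed

text \<open>
  Regular nonseparable sets of degree at most \<open>1\<close> are cliques and those of degree \<open>2\<close> are cycles.
\<close>
lemma eliminable_nonseparable:
  assumes "finite B" "nonseparable E B" "\<not> clique_on E B" "\<not> cycle_on E B"
    "\<forall>v\<in>B. f v = int (deg E B v) - 1"
  shows "eliminable E B f"
proof (cases "regular_on E B")
  case True
  obtain v where v: "v \<in> B" using assms(2) unfolding nonseparable_def by blast
  then obtain d where reg: "\<forall>x\<in>B. deg E B x = d"
    using True unfolding regular_on_def by blast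
  have "\<not> d \<le> 1"
    using nonseparable_small_deg_clique[OF assms(1,2) v] assms(3) reg v by auto
  moreover have "d \<noteq> 2"
  proof
    assume "d = 2"
    then have "cycle_on E B"
      by (intro cycle_on_if_two_regular[OF assms(1) nonseparable_connected[OF assms(2)]])
        (use reg v in auto)
    then show False using assms(4) by blast
  qed
  ultimately have "3 \<le> d" by linarith
  then show ?thesis
    by (rule eliminable_regular_nonclique[OF assms(1-3) reg _ assms(5)])
next
  case False
  then show ?thesis using eliminable_irregular assms by blast
qed

end

section \<open>Blocks and degeneracy in terms of vertex sets\<close>
lemma (in graph) adjacency_arcs_ends: "adjacency (arcs_ends G)"
  by unfold_locales (use graph_symmetric adj_not_same in blast)+

lemma arcs_ends_del_vert:
  "arcs_ends (pre_digraph.del_vert H u) = arcs_ends H \<inter> (- {u}) \<times> (- {u})"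
  by (auto simp: arcs_ends_conv pre_digraph.del_vert_simps)

lemma arcs_ends_induce: "arcs_ends (H \<restriction> S) = arcs_ends H \<inter> S \<times> S"
  by (auto simp: arcs_ends_conv)

lemma (in wf_digraph) arcs_ends_subset: "arcs_ends G \<subseteq> verts G \<times> verts G"
  using adj_in_verts by auto

lemma linked_cong: "E \<inter> S \<times> S = F \<inter> S \<times> S \<Longrightarrow> linked E S a b \<longleftrightarrow> linked F S a b"
  by (simp add: linked_def)

lemma connected_on_cong:
  "E \<inter> S \<times> S = F \<inter> S \<times> S \<Longrightarrow> connected_on E S \<longleftrightarrow> connected_on F S"
  by (simp add: connected_on_def linked_def)

lemma nonseparable_cong:
  assumes "E \<inter> S \<times> S = F \<inter> S \<times> S"
  shows "nonseparable E S \<longleftrightarrow> nonseparable F S"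
proof -
  have "E \<inter> (S - {v}) \<times> (S - {v}) = F \<inter> (S - {v}) \<times> (S - {v})" for v
    using assms by blast
  then show ?thesis
    unfolding nonseparable_def using connected_on_cong[OF assms] connected_on_cong by metis
qed

lemma nonseparable_mono: "nonseparable E S \<Longrightarrow> E \<subseteq> F \<Longrightarrow> nonseparable F S"
  unfolding nonseparable_def using connected_on_mono[of E _ F] by simp

lemma (in wf_digraph) reachable_iff_linked:
  "u \<rightarrow>\<^sup>* v \<longleftrightarrow> u \<in> verts G \<and> v \<in> verts G \<and> linked (arcs_ends G) (verts G) u v"
proof -
  have "arcs_ends G \<inter> verts G \<times> verts G = arcs_ends G" using arcs_ends_subset by blast
  then show ?thesis by (auto simp: reachable_conv linked_def)
qed

lemma (in wf_digraph) reachable_del_vert_iff_linked: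
  "a \<rightarrow>\<^sup>*\<^bsub>del_vert v\<^esub> b \<longleftrightarrow>
     a \<in> verts G - {v} \<and> b \<in> verts G - {v} \<and> linked (arcs_ends G) (verts G - {v}) a b"
proof -
  interpret D: wf_digraph "del_vert v" by (rule wf_digraph_del_vert)
  have "arcs_ends (del_vert v) \<inter> (verts G - {v}) \<times> (verts G - {v}) =
      arcs_ends G \<inter> (verts G - {v}) \<times> (verts G - {v})"
    by (auto simp: arcs_ends_del_vert)
  from linked_cong[OF this, of a b] show ?thesis
    by (simp add: D.reachable_iff_linked verts_del_vert)
qed

lemma (in graph) connected_iff_connected_on:
  "connected G \<longleftrightarrow> verts G \<noteq> {} \<and> connected_on (arcs_ends G) (verts G)"
  unfolding connected_def strongly_connected_def
  using reachable_mk_symmetric_eq[OF sym_arcs]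
  by (auto simp: reachable_iff_linked connected_on_def)

lemma (in graph) nonseparable_iff:
  "nonseparable (arcs_ends G) (verts G) \<longleftrightarrow> connected G \<and> (\<forall>v. \<not> cut_vertex G v)"
proof -
  have "connected_on (arcs_ends G) (verts G - {v}) \<longleftrightarrow> \<not> cut_vertex G v"
    if "connected_on (arcs_ends G) (verts G)" "v \<in> verts G" for v
    using that unfolding cut_vertex_def reachable_iff_linked reachable_del_vert_iff_linked
      connected_on_def by blast
  moreover have "\<not> cut_vertex G v" if "v \<notin> verts G" for v
    using that by (simp add: cut_vertex_def)
  ultimately show ?thesis
    unfolding nonseparable_def connected_iff_connected_on by blast
qed

lemma (in graph) graph_induce: "S \<subseteq> verts G \<Longrightarrow> graph (G \<restriction> S)"
proof -
  assume "S \<subseteq> verts G"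
  then have i: "induced_subgraph (G \<restriction> S) G" by (rule induced_induce)
  interpret D: digraph "G \<restriction> S" using i by (rule digraphI_induced)
  interpret Y: sym_digraph "G \<restriction> S" using i by (rule induced_graph_imp_graph)
  show ?thesis by unfold_locales
qed

lemma (in graph) nonseparable_induce_iff:
  assumes "S \<subseteq> verts G"
  shows "nonseparable (arcs_ends G) S \<longleftrightarrow>
    connected (G \<restriction> S) \<and> (\<forall>v. \<not> cut_vertex (G \<restriction> S) v)"
proof -
  interpret H: graph "G \<restriction> S" using assms by (rule graph_induce)
  have "nonseparable (arcs_ends G) S \<longleftrightarrow> nonseparable (arcs_ends (G \<restriction> S)) S"
    by (rule nonseparable_cong) (auto simp: arcs_ends_induce)
  then show ?thesis using H.nonseparable_iff by simp
qed

lemma subgraph_antisym: "subgraph H G \<Longrightarrow> subgraph G H \<Longrightarrow> H = G"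
  by (intro pre_digraph.equality) (auto simp: subgraph_def compatible_def)

text \<open>
  Filling in all arcs of \<open>G\<close> between the vertices of a block creates no cut vertex, so maximality forbids
  missing arcs.
\<close>
lemma (in graph) block_is_induced:
  assumes "block G B"
  shows "verts B \<subseteq> verts G" "B = G \<restriction> verts B" "nonseparable (arcs_ends G) (verts B)"
proof -
  have sub: "subgraph B G" and gB: "graph B" and B: "connected B" "\<forall>v. \<not> cut_vertex B v"
    and max: "\<And>H. H \<noteq> B \<Longrightarrow> subgraph B H \<Longrightarrow> subgraph H G \<Longrightarrow>
      \<not> (graph H \<and> connected H \<and> (\<forall>v. \<not> cut_vertex H v))"
    using assms unfolding block_def max_subgraph_def by auto
  show V: "verts B \<subseteq> verts G" using sub by blast
  have "nonseparable (arcs_ends B) (verts B)"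
    using graph.nonseparable_iff[OF gB] B by blast
  then show ns: "nonseparable (arcs_ends G) (verts B)"
    by (rule nonseparable_mono) (rule arcs_ends_mono[OF sub])
  show "B = G \<restriction> verts B"
    using max[of "G \<restriction> verts B"] subgraph_induce_subgraphI2[OF sub] subgraph_induce_subgraphI[OF V]
      graph_induce[OF V] nonseparable_induce_iff[OF V] ns by metis
qed

lemma (in graph) block_induce:
  assumes "S \<subseteq> verts G" "nonseparable (arcs_ends G) S"
    and max: "\<And>T. S \<subseteq> T \<Longrightarrow> T \<subseteq> verts G \<Longrightarrow> nonseparable (arcs_ends G) T \<Longrightarrow> T = S"
  shows "block G (G \<restriction> S)"
  unfolding block_def
proof (rule max_subgraphI)
  show "graph (G \<restriction> S) \<and> connected (G \<restriction> S) \<and> (\<forall>v. \<not> cut_vertex (G \<restriction> S) v)"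
    using assms nonseparable_induce_iff graph_induce by blast
  show "subgraph (G \<restriction> S) G" using assms(1) by (rule subgraph_induce_subgraphI)
  fix H assume H: "G \<restriction> S \<noteq> H" "subgraph (G \<restriction> S) H" "subgraph H G"
  show "\<not> (graph H \<and> connected H \<and> (\<forall>v. \<not> cut_vertex H v))"
  proof
    assume *: "graph H \<and> connected H \<and> (\<forall>v. \<not> cut_vertex H v)"
    then have "nonseparable (arcs_ends H) (verts H)"
      using graph.nonseparable_iff by blast
    then have "nonseparable (arcs_ends G) (verts H)"
      by (rule nonseparable_mono) (rule arcs_ends_mono[OF H(3)])
    moreover have "S \<subseteq> verts H" "verts H \<subseteq> verts G"
      using subgraph_imp_subverts[OF H(2)] subgraph_imp_subverts[OF H(3)] by simp_all
    ultimately have "verts H = S" using max by blast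
    then have "subgraph H (G \<restriction> S)"
      using subgraph_induce_subgraphI2[OF H(3)] by simp
    then show False using H(1,2) subgraph_antisym by blast
  qed
qed

lemma (in graph) complete_graph_induce_iff:
  assumes "S \<subseteq> verts G"
  shows "complete_graph (G \<restriction> S) \<longleftrightarrow> clique_on (arcs_ends G) S"
  using graph_induce[OF assms] adjacency.adj_irrefl[OF adjacency_arcs_ends]
  unfolding complete_graph_def complete_digraph_def clique_on_def arcs_ends_induce
  by (auto simp: set_eq_iff)

lemma (in graph) cycle_graph_induce_iff:
  assumes "S \<subseteq> verts G"
  shows "cycle_graph (G \<restriction> S) \<longleftrightarrow> cycle_on (arcs_ends G) S"
  using graph_induce[OF assms] by (simp add: cycle_graph_def cycle_on_def arcs_ends_induce)

text \<open>
  A nonseparable set sits inside a block. In a clique every subset is regular; in a cycle the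
  degrees are at most \<open>2\<close>, and a nonseparable subset with a vertex of smaller degree is a clique.
\<close>
lemma (in graph) GDP_tree_regular:
  assumes "GDP_tree G" "S \<subseteq> verts G" "nonseparable (arcs_ends G) S"
  shows "regular_on (arcs_ends G) S"
proof -
  interpret adjacency "arcs_ends G" by (rule adjacency_arcs_ends)
  obtain T where T: "S \<subseteq> T" "T \<subseteq> verts G" "nonseparable (arcs_ends G) T"
    and max: "\<forall>T'. T \<subseteq> T' \<longrightarrow> T' \<subseteq> verts G \<longrightarrow> nonseparable (arcs_ends G) T' \<longrightarrow> T' = T"
    using exists_maximal_nonseparable[OF finite_verts assms(2,3)] by blast
  have fin: "finite T" "finite S" using T(1,2) finite_verts by (meson finite_subset)+
  have "block G (G \<restriction> T)" by (rule block_induce) (use T max in blast)+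
  then consider "clique_on (arcs_ends G) T" | "cycle_on (arcs_ends G) T"
    using assms(1) complete_graph_induce_iff[OF T(2)] cycle_graph_induce_iff[OF T(2)]
    unfolding GDP_tree_def by blast
  then show ?thesis
  proof cases
    case 1
    then have "clique_on (arcs_ends G) S" using T(1) by (auto simp: clique_on_def)
    then show ?thesis using clique_on_regular adj_irrefl by blast
  next
    case 2
    have "deg (arcs_ends G) S v \<le> 2" if "v \<in> S" for v
      using deg_mono[OF T(1) fin(1), of "arcs_ends G" v] deg_cycle_on[OF 2, of v] that T(1)
      by force
    then show ?thesis using regular_on_if_deg_le_2[OF fin(2) assms(3)] by blast
  qed
qed

lemma (in graph) out_degree_eq_deg: "out_degree G u = deg (arcs_ends G) (verts G) u"
proof -
  have "inj_on (head G) (out_arcs G u)"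
    by (rule inj_onI) (auto intro!: no_multi_arcs simp: arc_to_ends_def)
  moreover have "head G ` out_arcs G u = nbrs (arcs_ends G) (verts G) u"
    by (auto simp: nbrs_def arcs_ends_conv)
  ultimately show ?thesis
    by (metis card_image deg_def out_degree_def)
qed

lemma removable_imp_eliminable:
  assumes "removable H f" "arcs_ends H = E \<inter> verts H \<times> verts H"
  shows "eliminable E (verts H) f"
  using assms
proof (induction rule: removable.induct)
  case (Empty H f)
  then show ?case by (simp add: eliminable.empty)
next
  case (Delete u H f)
  have "Delete_fun H f u = lower E (verts H) u {} f"
    using Delete.prems by (auto simp: Delete_fun_def lower_def)
  moreover have "arcs_ends (pre_digraph.del_vert H u) = E \<inter> (verts H - {u}) \<times> (verts H - {u})"
    using Delete.prems by (auto simp: arcs_ends_del_vert)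
  ultimately show ?case
    using Delete eliminable.step[of u "verts H" "{}" E f]
    by (simp add: nonneg_on_def pre_digraph.verts_del_vert)
next
  case (DelSave u H w f)
  have "DelSave_fun H f u w = lower E (verts H) u {w} f"
    using DelSave.prems by (auto simp: DelSave_fun_def lower_def)
  moreover have "arcs_ends (pre_digraph.del_vert H u) = E \<inter> (verts H - {u}) \<times> (verts H - {u})"
    using DelSave.prems by (auto simp: arcs_ends_del_vert)
  ultimately show ?case
    using DelSave eliminable.step[of u "verts H" "{w}" E f]
    by (simp add: nonneg_on_def pre_digraph.verts_del_vert)
qed

lemma eliminable_imp_removable:
  assumes "eliminable E V f" "verts H = V" "arcs_ends H = E \<inter> V \<times> V"
  shows "removable H f"
  using assms
proof (induction arbitrary: H rule: eliminable.induct)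
  case (empty f)
  then show ?case by (intro removable.Empty)
next
  case (step u V W f)
  let ?H = "pre_digraph.del_vert H u"
  have e: "arcs_ends ?H = E \<inter> (V - {u}) \<times> (V - {u})"
    using step.prems by (auto simp: arcs_ends_del_vert)
  have v: "verts ?H = V - {u}" using step.prems by (simp add: pre_digraph.verts_del_vert)
  have rem: "removable ?H (lower E V u W f)" using step.IH[OF v e] .
  have nn: "nonneg_on ?H (lower E V u W f)"
    using step.hyps(3) v by (simp add: nonneg_on_def)
  from step.hyps(2) show ?case
  proof
    assume "W = {}"
    then have "lower E V u W f = Delete_fun H f u"
      using step.prems by (auto simp: Delete_fun_def lower_def)
    then show ?thesis
      using removable.Delete[of u H f] rem nn step by simp
  next
    assume "\<exists>w\<in>V. W = {w} \<and> (u, w) \<in> E \<and> f w < f u"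
    then obtain w where w: "w \<in> V" "W = {w}" "(u, w) \<in> E" "f w < f u" by blast
    then have "lower E V u W f = DelSave_fun H f u w"
      using step.prems by (auto simp: DelSave_fun_def lower_def)
    then show ?thesis
      using removable.DelSave[of u H w f] rem nn step w by simp
  qed
qed

lemma (in graph) removable_iff_eliminable:
  "removable G f \<longleftrightarrow> eliminable (arcs_ends G) (verts G) f"
proof -
  have "arcs_ends G = arcs_ends G \<inter> verts G \<times> verts G" using arcs_ends_subset by blast
  then show ?thesis using removable_imp_eliminable eliminable_imp_removable by metis
qed

section \<open>GDP-trees and weak degeneracy\<close>
theorem theorem1p6:
  fixes G :: "('a, 'b) pre_digraph"
  assumes "graph G" and "Digraph_Component.connected G"
  shows "weakly_degenerate G (\<lambda>u. int (out_degree G u) - 1) \<longleftrightarrow> \<not> GDP_tree G"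
proof -
  interpret graph G by (rule assms(1))
  let ?E = "arcs_ends G" and ?V = "verts G" and ?f = "\<lambda>u. int (out_degree G u) - 1"
  interpret adjacency ?E by (rule adjacency_arcs_ends)
  have ne: "?V \<noteq> {}" and con: "connected_on ?E ?V"
    using assms(2) connected_iff_connected_on by auto
  have f: "?f = (\<lambda>u. int (deg ?E ?V u) - 1)" by (simp add: out_degree_eq_deg)
  show ?thesis
  proof
    assume wd: "weakly_degenerate G ?f"
    show "\<not> GDP_tree G"
    proof
      assume gdp: "GDP_tree G"
      show False
      proof (rule not_eliminable_if_regular_pieces[of ?V ?f ?V])
        show "eliminable ?E ?V ?f" "\<forall>v\<in>?V. 0 \<le> ?f v"
          using wd by (simp_all add: weakly_degenerate_def removable_iff_eliminable nonneg_on_def)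
        show "regular_on ?E S" if "S \<subseteq> ?V" "nonseparable ?E S" for S
          using GDP_tree_regular[OF gdp that] .
      qed (use ne con f in \<open>auto simp: fun_eq_iff\<close>)
    qed
  next
    assume "\<not> GDP_tree G"
    then obtain B where "block G B" and no: "\<not> complete_graph B" "\<not> cycle_graph B"
      using assms unfolding GDP_tree_def by blast
    then obtain S where S: "S \<subseteq> ?V" "nonseparable ?E S" and B: "B = G \<restriction> S"
      using block_is_induced by metis
    have nS: "\<not> clique_on ?E S" "\<not> cycle_on ?E S"
      using no complete_graph_induce_iff[OF S(1)] cycle_graph_induce_iff[OF S(1)] B by auto
    have fS: "finite S" using S(1) finite_verts finite_subset by blast
    obtain a b where ab: "a \<in> S" "b \<in> S" "a \<noteq> b"
      using nS(1) by (auto simp: clique_on_def)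
    have "card {a, b} \<le> card S" using ab fS by (intro card_mono) auto
    then have c2: "2 \<le> card S" using ab by simp
    have "eliminable ?E ?V ?f"
    proof (rule eliminable_if_subset_eliminable[OF finite_verts con S(1) nonseparable_connected[OF S(2)] c2])
      show "eliminable ?E S g" if "\<forall>v\<in>S. g v = int (deg ?E S v) - 1" for g
        using eliminable_nonseparable[OF fS S(2) nS that] .
    qed (simp add: out_degree_eq_deg)
    moreover have "0 \<le> ?f v" if "v \<in> ?V" for v
    proof -
      obtain y where "y \<in> ?V" "y \<noteq> v" using ab S(1) by blast
      then show ?thesis
        using deg_connected_pos[OF con finite_verts that, of y] by (simp add: out_degree_eq_deg)
    qed
    ultimately show "weakly_degenerate G ?f"
      by (simp add: weakly_degenerate_def removable_iff_eliminable nonneg_on_def)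
  qed
qed

end
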